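(* Let $w\in F_n$ be a non-empty cyclically reduced word and suppose that $P_n(w)$ is orientable. If $P_n(w)$ is $(m,k,\nu)$-special with $m\geq 3$ (for some $k\geq 3$, $\nu\geq 1$) then $m=3$ and $w$ is positive or negative.
   Context: $F_n$ is the free group with basis $x_0,\ldots,x_{n-1}$; subscripts are taken modulo $n$; $\theta(x_i)=x_{i+1}$. $P_n(w)=\langle x_0,\ldots,x_{n-1}\mid w,\theta(w),\ldots,\theta^{n-1}(w)\rangle$; it is orientable if $w$ is not a cyclic permutation of the inverse of any of its shifts $\theta^i(w)$, $0\leq i<n$. A non-empty word is positive (resp. negative) if all exponents of generators in it are positive (resp. negative). Star graph: for a presentation $\langle X\mid R\rangle$ with cyclically reduced relators, let $\tilde R$ be the set of all cyclic permutations of elements of $R\cup R^{-1}$. The star graph is the undirected graph (multiple edges allowed) with vertex set $X\cup X^{-1}$ and an edge joining $x$ and $y$ ($x,y\in X\cup X^{-1}$) for each distinct word in $\tilde R$ of the form $xy^{-1}z$, where the edges arising from the inverse pair $xy^{-1}z$ and $yx^{-1}z^{-1}$ are identified. $(m,k,\nu)$-special: let $m\geq 2$, $k\geq 3$, $\nu\geq 1$. A finite presentation is $(m,k,\nu)$-special if (a) its star graph has $\nu$ connected components, which are pairwise isomorphic, each being a connected bipartite graph of diameter $m$ and girth $2m$ in which each vertex has degree at least $3$; (b) each relator has length $k$; (c) if $m=2$ then $k\geq 4$. (Girth is the minimal length of a reduced closed path; a pair of parallel edges gives girth at most $2$.) *)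

theory Defs
  imports "Graph_Theory.Graph_Theory" "HOL-Library.Extended_Nat"
begin

section \<open>Words and presentations\<close>

text \<open>The letter \<open>(x, True)\<close> is the generator \<open>x\<close>, and \<open>(x, False)\<close> is its inverse. An element of
  a free group is given by its reduced word.\<close>

type_synonym 'a letter = "'a \<times> bool"
type_synonym 'a word = "'a letter list"

definition inv_letter :: "'a letter \<Rightarrow> 'a letter" where
  "inv_letter a = (fst a, \<not> snd a)"

definition inv_word :: "'a word \<Rightarrow> 'a word" where
  "inv_word w = rev (map inv_letter w)"

definition word_over :: "'a set \<Rightarrow> 'a word \<Rightarrow> bool" where
  "word_over X w \<longleftrightarrow> fst ` set w \<subseteq> X"

definition reduced :: "'a word \<Rightarrow> bool" where
  "reduced w \<longleftrightarrow> successively (\<lambda>a b. b \<noteq> inv_letter a) w"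

definition cyclically_reduced :: "'a word \<Rightarrow> bool" where
  "cyclically_reduced w \<longleftrightarrow> reduced w \<and> (w \<noteq> [] \<longrightarrow> hd w \<noteq> inv_letter (last w))"

definition cyclic_permutation :: "'a word \<Rightarrow> 'a word \<Rightarrow> bool" where
  "cyclic_permutation u v \<longleftrightarrow> (\<exists>j. u = rotate j v)"

definition positive_word :: "'a word \<Rightarrow> bool" where
  "positive_word w \<longleftrightarrow> w \<noteq> [] \<and> (\<forall>a\<in>set w. snd a)"

definition negative_word :: "'a word \<Rightarrow> bool" where
  "negative_word w \<longleftrightarrow> w \<noteq> [] \<and> (\<forall>a\<in>set w. \<not> snd a)"


section \<open>Bidirected graphs\<close>

text \<open>An undirected multigraph is represented, as in the locale \<open>bidirected_digraph\<close>, by a digraph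
  \<open>G\<close> with an involution \<open>rv\<close> that reverses its arcs: an undirected edge is a pair
  \<open>{a, rv a}\<close> of opposite arcs. Hence the degree of a vertex is its \<open>out_degree\<close>, paths are
  arc walks, and the connected components are the members of \<open>sccs\<close>.\<close>

definition bidirected_iso ::
  "('b \<Rightarrow> 'b) \<Rightarrow> ('a, 'b) pre_digraph \<Rightarrow> ('a, 'b) pre_digraph \<Rightarrow> bool" where
  "bidirected_iso rv G H \<longleftrightarrow>
    (\<exists>f. pre_digraph.digraph_isomorphism G f \<and> H = app_iso f G \<and>
         (\<forall>a\<in>arcs G. iso_arcs f (rv a) = rv (iso_arcs f a)))"

definition bipartite :: "('a, 'b) pre_digraph \<Rightarrow> bool" where
  "bipartite G \<longleftrightarrow>
    (\<exists>A B. A \<union> B = verts G \<and> A \<inter> B = {} \<and>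
       (\<forall>e\<in>arcs G. tail G e \<in> A \<and> head G e \<in> B \<or> tail G e \<in> B \<and> head G e \<in> A))"

definition vdist :: "('a, 'b) pre_digraph \<Rightarrow> 'a \<Rightarrow> 'a \<Rightarrow> enat" where
  "vdist G u v = (INF p\<in>{p. pre_digraph.awalk G u p v}. enat (length p))"

definition diam :: "('a, 'b) pre_digraph \<Rightarrow> enat" where
  "diam G = (SUP u\<in>verts G. SUP v\<in>verts G. vdist G u v)"

definition reduced_path :: "('b \<Rightarrow> 'b) \<Rightarrow> 'b awalk \<Rightarrow> bool" where
  "reduced_path rv p \<longleftrightarrow> successively (\<lambda>a b. b \<noteq> rv a) p"

text \<open>The girth is \<open>\<infinity>\<close> if there is no non-empty reduced closed path.\<close>

definition girth :: "('b \<Rightarrow> 'b) \<Rightarrow> ('a, 'b) pre_digraph \<Rightarrow> enat" where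
  "girth rv G =
    (INF p\<in>{p. p \<noteq> [] \<and> reduced_path rv p \<and> (\<exists>u. pre_digraph.awalk G u p u)}. enat (length p))"


section \<open>Star graphs and special presentations\<close>

definition symmetrized :: "'a word set \<Rightarrow> 'a word set" where
  "symmetrized R = {u. \<exists>r \<in> R \<union> inv_word ` R. cyclic_permutation u r}"

text \<open>A word \<open>x y\<^sup>-\<^sup>1 z\<close> of the symmetrized set is an arc from \<open>x\<close> to \<open>y\<close>, and its
  reverse is the arc \<open>y x\<^sup>-\<^sup>1 z\<^sup>-\<^sup>1\<close>.\<close>

definition star_graph :: "'a set \<Rightarrow> 'a word set \<Rightarrow> ('a letter, 'a word) pre_digraph" where
  "star_graph X R =
    \<lparr> verts = X \<times> UNIV,
      arcs = {u \<in> symmetrized R. 2 \<le> length u},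
      tail = (\<lambda>u. u ! 0),
      head = (\<lambda>u. inv_letter (u ! 1)) \<rparr>"

fun star_rev :: "'a word \<Rightarrow> 'a word" where
  "star_rev (a # b # z) = inv_letter b # inv_letter a # inv_word z"
| "star_rev u = u"

definition special :: "nat \<Rightarrow> nat \<Rightarrow> nat \<Rightarrow> 'a set \<Rightarrow> 'a word set \<Rightarrow> bool" where
  "special m k \<nu> X R \<longleftrightarrow>
    2 \<le> m \<and> 3 \<le> k \<and> 1 \<le> \<nu> \<and>
    finite X \<and> finite R \<and> (\<forall>r\<in>R. word_over X r \<and> cyclically_reduced r) \<and>
    card (pre_digraph.sccs (star_graph X R)) = \<nu> \<and>
    (\<forall>C\<in>pre_digraph.sccs (star_graph X R). \<forall>D\<in>pre_digraph.sccs (star_graph X R).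
       bidirected_iso star_rev C D) \<and>
    (\<forall>C\<in>pre_digraph.sccs (star_graph X R).
       connected C \<and> bipartite C \<and> diam C = enat m \<and> girth star_rev C = enat (2 * m) \<and>
       (\<forall>v\<in>verts C. 3 \<le> out_degree C v)) \<and>
    (\<forall>r\<in>R. length r = k) \<and>
    (m = 2 \<longrightarrow> 4 \<le> k)"


section \<open>Cyclic presentations\<close>

text \<open>\<open>F\<^sub>n\<close> has basis \<open>{..<n}\<close>, where \<open>i\<close> stands for \<open>x\<^sub>i\<close>.\<close>

definition shift :: "nat \<Rightarrow> nat word \<Rightarrow> nat word" where
  "shift n w = map (\<lambda>(i, s). ((i + 1) mod n, s)) w"

definition cyclic_relators :: "nat \<Rightarrow> nat word \<Rightarrow> nat word set" where
  "cyclic_relators n w = {(shift n ^^ i) w | i. i < n}"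

definition orientable :: "nat \<Rightarrow> nat word \<Rightarrow> bool" where
  "orientable n w \<longleftrightarrow> (\<forall>i<n. \<not> cyclic_permutation w (inv_word ((shift n ^^ i) w)))"

end

theory Submission
  imports Defs
begin

text \<open>Rotating the generators makes the star graph a graph on two copies of \<open>\<int>/n\<close>, one for the
  generators and one for their inverses, whose edges are given by steps \<open>t \<in> \<int>/n\<close> between copies.
  If \<open>w\<close> is positive or negative, all steps lead from generators to inverses or back. The degree
  condition gives three of them, and since steps commute, they close up to a hexagon, so \<open>m \<le> 3\<close>.

  Otherwise there are a step \<open>d\<close> between generators and a step \<open>e\<close> between inverses. Both are unique
  up to sign, as two different ones would give a square, and \<open>2d \<noteq> 0 \<noteq> 2e\<close> by orientability. So
  every vertex has degree \<open>r = 2 + \<beta>\<close>, where \<open>\<beta>\<close> is the number of steps from generators to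
  inverses. Commuting steps now give a hexagon if \<open>\<beta> \<ge> 2\<close> and an octagon if \<open>\<beta> = 1\<close>, so \<open>m = 3\<close>, or
  \<open>m = 4\<close> and \<open>r = 3\<close>. In a generalized polygon with these parameters the sides of the bipartition
  have \<open>1 + r (r - 1)\<close>, respectively \<open>r + r (r - 1)\<^sup>2 = 15\<close>, vertices, an odd number. But the step
  \<open>d\<close> swaps the sides and preserves the generators, and a step to the inverses swaps the sides too,
  so each side consists of equally many generators and inverses.\<close>

section \<open>Graphs of given girth\<close>

text \<open>A vertex-level stand-in for \<open>reduced_path\<close>: an arc followed by its reverse
  shows up as \<open>x, y, x\<close>. Nothing is asked at the base point of a closed list, as in
  \<open>girth\<close>.\<close>

fun non_backtracking :: "'a list \<Rightarrow> bool" where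
  "non_backtracking (x # y # z # vs) \<longleftrightarrow> x \<noteq> z \<and> non_backtracking (y # z # vs)"
| "non_backtracking _ \<longleftrightarrow> True"

definition nb_walk :: "('a \<Rightarrow> 'a \<Rightarrow> bool) \<Rightarrow> 'a list \<Rightarrow> bool" where
  "nb_walk E vs \<longleftrightarrow> successively E vs \<and> non_backtracking vs"

text \<open>A closed list repeats its first vertex at the end, so \<open>2 * m < length vs\<close>
  means at least \<open>2 * m\<close> edges.\<close>

locale girth_graph =
  fixes E :: "'a \<Rightarrow> 'a \<Rightarrow> bool" and m :: nat
  assumes E_sym: "E p q \<Longrightarrow> E q p"
    and finite_neighbours: "finite {q. E p q}"
    and girth: "nb_walk E vs \<Longrightarrow> 2 \<le> length vs \<Longrightarrow> hd vs = last vs \<Longrightarrow> 2 * m < length vs"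
    and m_ge: "3 \<le> m"
begin

lemma no_square:
  "E p q \<Longrightarrow> E q r \<Longrightarrow> E r s \<Longrightarrow> E s p \<Longrightarrow> p \<noteq> r \<Longrightarrow> q \<noteq> s \<Longrightarrow> False"
  using girth[of "[p, q, r, s, p]"] m_ge by (auto simp: nb_walk_def)

text \<open>The closed list has seven entries, so \<open>2 * m < 7\<close>. The inequalities compare
  the two neighbours of each inner entry.\<close>

lemma hexagon_m_le:
  assumes "E a b" "E b c" "E c d" "E d e" "E e f" "E f a"
    and "a \<noteq> c" "b \<noteq> d" "c \<noteq> e" "d \<noteq> f" "e \<noteq> a"
  shows "m \<le> 3"
  using girth[of "[a, b, c, d, e, f, a]"] assms by (auto simp: nb_walk_def)

lemma octagon_m_le:
  assumes "E a b" "E b c" "E c d" "E d e" "E e f" "E f g" "E g h" "E h a"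
    and "a \<noteq> c" "b \<noteq> d" "c \<noteq> e" "d \<noteq> f" "e \<noteq> g" "f \<noteq> h"
      "g \<noteq> a"
  shows "m \<le> 4"
  using girth[of "[a, b, c, d, e, f, g, h, a]"] assms by (auto simp: nb_walk_def)

end

text \<open>\<open>S\<close> and \<open>T\<close> stand for the sides of one component, while
  \<open>E\<close> lives on the whole graph; hence the diameter bound stays within
  \<open>S \<union> T\<close>. A list of \<open>m + 1\<close> vertices has \<open>m\<close>
  edges.\<close>

locale bipartite_polygon = girth_graph E m for E :: "'a \<Rightarrow> 'a \<Rightarrow> bool" and m +
  fixes S T :: "'a set"
  assumes S_T_disjoint: "S \<inter> T = {}"
    and S_to_T: "p \<in> S \<Longrightarrow> E p q \<Longrightarrow> q \<in> T"
    and T_to_S: "p \<in> T \<Longrightarrow> E p q \<Longrightarrow> q \<in> S"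
    and diameter: "p \<in> S \<Longrightarrow> q \<in> S \<union> T \<Longrightarrow>
      \<exists>vs. successively E vs \<and> vs \<noteq> [] \<and> hd vs = p \<and> last vs = q \<and> length vs \<le> m + 1"
begin

section \<open>Counting a side by distance from a vertex\<close>

lemma not_both: "p \<in> S \<Longrightarrow> p \<in> T \<Longrightarrow> False"
  using S_T_disjoint by blast

text \<open>Four edges lead back to the side of \<open>p\<close>, so the last case records
  \<open>q \<in> S\<close> and drops out when \<open>q\<close> lies in \<open>T\<close>; it also
  records \<open>m = 4\<close> and drops out for diameter three.\<close>

lemma walk_cases:
  assumes "p \<in> S" "q \<in> S \<union> T" "m \<le> 4"
  obtains "q = p" | "E p q" | y where "E p y" "E y q" | y z where "E p y" "E y z" "E z q"
    | x y z where "E p x" "E x y" "E y z" "E z q" "q \<in> S" "m = 4"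
proof -
  obtain vs where vs: "successively E vs" "vs \<noteq> []" "hd vs = p" "last vs = q"
    "length vs \<le> m + 1"
    using diameter assms by blast
  have "length vs \<le> 5" using vs assms(3) by simp
  moreover have "0 < length vs" using vs(2) by simp
  ultimately consider "length vs = 1" | "length vs = 2" | "length vs = 3" | "length vs = 4" | "length vs = 5"
    by linarith
  then show thesis
  proof cases
    case 5
    then have "m = 4" using vs(5) assms(3) by simp
    from 5 obtain a b c d e where "vs = [a, b, c, d, e]"
      by (auto simp: length_Suc_conv eval_nat_numeral)
    then have w: "E p b" "E b c" "E c d" "E d q" using vs by auto
    have "q \<in> S"
      using T_to_S[OF S_to_T[OF T_to_S[OF S_to_T[OF assms(1) w(1)] w(2)] w(3)] w(4)] .
    then show thesis using that(5) w \<open>m = 4\<close> by blast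
  qed (use vs in \<open>auto simp: length_Suc_conv eval_nat_numeral intro: that\<close>)
qed

text \<open>Distances within \<open>S\<close> are even and at most three, so every vertex of
  \<open>S\<close> other than \<open>p\<close> is at distance two. Each of the \<open>r\<close>
  neighbours of \<open>p\<close> leads to \<open>r - 1\<close> of them, and none is reached twice,
  since that would close a square.\<close>

lemma card_side_3:
  assumes "m = 3" "p \<in> S"
    and deg: "\<And>q. q \<in> S \<union> T \<Longrightarrow> card {u. E q u} = r"
  shows "card S = 1 + r * (r - 1)"
proof -
  let ?N = "\<lambda>q. {u. E q u}"
  have "S \<subseteq> insert p (\<Union>y\<in>?N p. ?N y - {p})"
  proof
    fix q assume q: "q \<in> S"
    from assms(2) have "q \<in> S \<union> T" "m \<le> 4" using q assms by auto
    from assms(2) this show "q \<in> insert p (\<Union>y\<in>?N p. ?N y - {p})"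
    proof (cases rule: walk_cases)
      case 2
      then show ?thesis using not_both[OF q S_to_T[OF assms(2)]] by simp
    next
      case (4 y z)
      have "q \<in> T" using S_to_T[OF T_to_S[OF S_to_T[OF assms(2) 4(1)] 4(2)] 4(3)] .
      then show ?thesis using not_both[OF q] by simp
    qed (use assms(1) in auto)
  qed
  moreover have "(\<Union>y\<in>?N p. ?N y - {p}) \<subseteq> S" using assms(2) S_to_T T_to_S
    by blast
  ultimately have "S = insert p (\<Union>y\<in>?N p. ?N y - {p})"
    using assms(2) by (intro equalityI insert_subsetI)
  then have "card S = Suc (card (\<Union>y\<in>?N p. ?N y - {p}))"
    using finite_neighbours
      by (metis (no_types, lifting) DiffE UN_E card_insert_disjoint finite_Diff finite_UN_I singletonI)
  also have "card (\<Union>y\<in>?N p. ?N y - {p}) = (\<Sum>y\<in>?N p. card (?N y - {p}))"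
  proof (rule card_UN_disjoint)
    have False if "E p y" "E p y'" "y \<noteq> y'" "E y q" "E y' q" "q \<noteq> p" for y y' q
      using no_square[of p y q y'] that E_sym by blast
    then show "\<forall>y\<in>?N p. \<forall>y'\<in>?N p. y \<noteq> y' \<longrightarrow> (?N y - {p}) \<inter> (?N y' - {p}) = {}"
      by blast
  qed (simp_all add: finite_neighbours)
  also have "\<dots> = (\<Sum>y\<in>?N p. r - 1)"
  proof (rule sum.cong)
    fix y assume "y \<in> ?N p"
    then show "card (?N y - {p}) = r - 1"
      using deg[of y] E_sym assms(2) S_to_T by (simp add: card_Diff_singleton)
  qed simp
  finally show ?thesis using deg assms(2) by simp
qed

text \<open>Seen from \<open>p\<close>, the other side consists of \<open>r\<close> vertices at
  distance one and the ends of the \<open>r * (r - 1)\<^sup>2\<close> reduced walks with three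
  edges. Two such walks with the same end would close a square or a hexagon, against girth
  eight.\<close>

lemma card_side_4:
  assumes "m = 4" "p \<in> S"
    and deg: "\<And>q. q \<in> S \<union> T \<Longrightarrow> card {u. E q u} = r"
  shows "card T = r + r * (r - 1)\<^sup>2"
proof -
  let ?N = "\<lambda>q. {u. E q u}"
  let ?W = "\<lambda>y. \<Union>z\<in>?N y - {p}. ?N z - {y}"
  have short: False if "nb_walk E vs" "2 \<le> length vs" "length vs \<le> 8" "hd vs = last vs"
    for vs
    using girth[of vs] that assms(1) by simp
  have "T \<subseteq> ?N p \<union> (\<Union>y\<in>?N p. ?W y)"
  proof
    fix q assume q: "q \<in> T"
    from assms(2) have "q \<in> S \<union> T" "m \<le> 4" using q assms by auto
    from assms(2) this show "q \<in> ?N p \<union> (\<Union>y\<in>?N p. ?W y)"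
    proof (cases rule: walk_cases)
      case (3 y)
      have "q \<in> S" using T_to_S[OF S_to_T[OF assms(2) 3(1)] 3(2)] .
      then show ?thesis using not_both[OF _ q] by simp
    next
      case (4 y z)
      \<comment> \<open>A walk \<open>p, y, z, q\<close> that turns back ends at a neighbour of
        \<open>p\<close>.\<close>
      then show ?thesis by (cases "z = p"; cases "q = y") auto
    qed (use not_both[OF _ q] assms(2) in auto)
  qed
  moreover have "?N p \<union> (\<Union>y\<in>?N p. ?W y) \<subseteq> T"
    using assms(2) S_to_T T_to_S by blast
  ultimately have T: "T = ?N p \<union> (\<Union>y\<in>?N p. ?W y)" by (rule equalityI)
  have "card T = card (?N p) + card (\<Union>y\<in>?N p. ?W y)"
    unfolding T
  proof (rule card_Un_disjoint)
    show "?N p \<inter> (\<Union>y\<in>?N p. ?W y) = {}"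
    proof -
      \<comment> \<open>A neighbour of \<open>p\<close> that also ends a reduced walk with three
        edges from \<open>p\<close> would close a square.\<close>
      have False if "E p q" "E p y" "E y z" "z \<noteq> p" "E z q" "q \<noteq> y" for q y z
        using no_square[of p q z y] that E_sym by blast
      then show ?thesis by blast
    qed
  qed (simp_all add: finite_neighbours)
  also have "card (\<Union>y\<in>?N p. ?W y) = (\<Sum>y\<in>?N p. card (?W y))"
  proof (rule card_UN_disjoint)
    have False if "E p y" "E p y'" "y \<noteq> y'" "E y z" "E y' z'" "z \<noteq> p" "z' \<noteq> p"
      "E z q" "E z' q" "q \<noteq> y" "q \<noteq> y'" for y y' z z' q
    proof (cases "z = z'")
      case True
      then show False using no_square[of p y z y'] that E_sym by blast
    next
      case False
      then show False using short[of "[p, y, z, q, z', y', p]"] that E_sym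
        by (auto simp: nb_walk_def)
    qed
    then show "\<forall>y\<in>?N p. \<forall>y'\<in>?N p. y \<noteq> y' \<longrightarrow> ?W y \<inter> ?W y' = {}" by blast
  qed (simp_all add: finite_neighbours)
  also have "\<dots> = (\<Sum>y\<in>?N p. (r - 1)\<^sup>2)"
  proof (rule sum.cong)
    fix y assume y: "y \<in> ?N p"
    have "card (?W y) = (\<Sum>z\<in>?N y - {p}. card (?N z - {y}))"
    proof (rule card_UN_disjoint)
      have False if "E y z" "E y z'" "z \<noteq> z'" "E z q" "E z' q" "q \<noteq> y" for z z' q
        using no_square[of y z q z'] that E_sym by blast
      then show "\<forall>z\<in>?N y - {p}. \<forall>z'\<in>?N y - {p}. z \<noteq> z' \<longrightarrow> (?N z - {y}) \<inter> (?N z' - {y}) = {}"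
        by blast
    qed (simp_all add: finite_neighbours)
    also have "\<dots> = (\<Sum>z\<in>?N y - {p}. r - 1)"
    proof (rule sum.cong)
      fix z assume z: "z \<in> ?N y - {p}"
      have "z \<in> S" using z y assms(2) S_to_T T_to_S by blast
      then show "card (?N z - {y}) = r - 1"
        using deg E_sym z by (simp add: card_Diff_singleton)
    qed simp
    also have "\<dots> = card (?N y - {p}) * (r - 1)" by simp
    also have "card (?N y - {p}) = r - 1"
      using deg[of y] E_sym y assms(2) S_to_T by (simp add: card_Diff_singleton)
    finally show "card (?W y) = (r - 1)\<^sup>2" by (simp add: power2_eq_square)
  qed simp
  finally show ?thesis using deg assms(2) by simp
qed

end

section \<open>Graphs on two copies of the cyclic group\<close>

text \<open>Indices are integers reduced modulo \<open>n\<close>, so that steps can be added and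
  negated freely.\<close>

definition cyc_vertex :: "nat \<Rightarrow> int \<Rightarrow> bool \<Rightarrow> nat letter" where
  "cyc_vertex n t s = (nat (t mod int n), s)"

text \<open>\<open>no_half_turn\<close> carries orientability: it forbids an edge inside a copy
  whose step is its own negative.\<close>

locale cyclic_graph = girth_graph E m for E :: "nat letter \<Rightarrow> nat letter \<Rightarrow> bool" and m +
  fixes n :: nat
  assumes n_pos: "0 < n"
    and E_dom: "E p q \<Longrightarrow> fst p < n"
    and E_shift: "E (i, s) (j, s') \<Longrightarrow> E ((i + 1) mod n, s) ((j + 1) mod n, s')"
    and degree: "fst p < n \<Longrightarrow> 3 \<le> card {q. E p q}"
    and no_half_turn: "E (i, s) (j, s) \<Longrightarrow> (2 * i) mod n \<noteq> (2 * j) mod n"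
begin

section \<open>Edges as steps of the cyclic group\<close>

abbreviation "v \<equiv> cyc_vertex n"

text \<open>By rotation invariance the edges at index 0 determine all others; \<open>E_iff\<close>
  makes adjacency a condition on the difference of the indices.\<close>

definition D :: "bool \<Rightarrow> bool \<Rightarrow> int \<Rightarrow> bool" where
  "D s s' t \<longleftrightarrow> E (v 0 s) (v t s')"

text \<open>Residues instead of arbitrary integers, so that the steps correspond one-to-one to the
  neighbours of opposite sign and can be counted.\<close>

definition mixed_steps :: "bool \<Rightarrow> int set" where
  "mixed_steps s = {t \<in> {0..<int n}. D s (\<not> s) t}"

lemma v_eq_iff: "v t s = v t' s' \<longleftrightarrow> t mod int n = t' mod int n \<and> s = s'"
  using n_pos by (auto simp: cyc_vertex_def eq_nat_nat_iff)

lemma v_add_eq_iff [simp]: "v (i + t) s = v (i + t') s' \<longleftrightarrow> v t s = v t' s'"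
  unfolding v_eq_iff by (metis add_diff_cancel_left' mod_add_right_eq mod_diff_left_eq)

lemma v_of_fst: "fst p < n \<Longrightarrow> p = v (int (fst p)) (snd p)"
  by (cases p) (simp add: cyc_vertex_def)

lemma fst_v: "fst (v t s) < n"
  using n_pos by (simp add: cyc_vertex_def nat_less_iff)

lemma E_shift_one: "E (v i s) (v j s') \<Longrightarrow> E (v (i + 1) s) (v (j + 1) s')"
proof -
  assume "E (v i s) (v j s')"
  from E_shift[OF this[unfolded cyc_vertex_def]]
  have *: "E ((nat (i mod int n) + 1) mod n, s) ((nat (j mod int n) + 1) mod n, s')" .
  have "(nat (t mod int n) + 1) mod n = nat ((t + 1) mod int n)" for t
  proof -
    have "int ((nat (t mod int n) + 1) mod n) = (t mod int n + 1) mod int n"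
      using n_pos by (simp add: zmod_int add.commute)
    then show ?thesis by (simp add: mod_add_left_eq nat_eq_iff2 flip: nat_int)
  qed
  with * show ?thesis by (simp add: cyc_vertex_def)
qed

lemma E_shift_nat: "E (v i s) (v j s') \<Longrightarrow> E (v (i + int t) s) (v (j + int t) s')"
  by (induction t) (use E_shift_one in \<open>fastforce simp: algebra_simps\<close>)+

text \<open>A possibly negative \<open>t\<close> is replaced by its residue, which is a natural
  number.\<close>

lemma E_shift_int: "E (v i s) (v j s') \<Longrightarrow> E (v (i + t) s) (v (j + t) s')"
proof -
  assume "E (v i s) (v j s')"
  from E_shift_nat[OF this, of "nat (t mod int n)"]
  have "E (v (i + t mod int n) s) (v (j + t mod int n) s')" using n_pos by simp
  moreover have "v (k + t mod int n) s = v (k + t) s" for k s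
    by (simp add: cyc_vertex_def mod_add_right_eq)
  ultimately show ?thesis by simp
qed

lemma E_iff: "E (v i s) (v j s') \<longleftrightarrow> D s s' (j - i)"
  using E_shift_int[of i s j s' "- i"] E_shift_int[of 0 s "j - i" s' i] by (auto simp: D_def)

lemma D_sym: "D s s' t \<Longrightarrow> D s' s (- t)"
  using E_sym[of "v 0 s" "v t s'"] by (simp add: E_iff)

lemma D_cong: "v t s' = v t' s' \<Longrightarrow> D s s' t \<longleftrightarrow> D s s' t'"
  by (simp add: D_def)

section \<open>Steps inside a copy and vertex degrees\<close>

lemma no_half_step:
  assumes "D s s d"
  shows "v d s \<noteq> v (- d) s"
proof
  assume "v d s = v (- d) s"
  then have "d mod int n = (- d) mod int n" by (simp add: v_eq_iff)
  then have "(d + d) mod int n = (- d + d) mod int n" by (metis mod_add_left_eq)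
  then have "(2 * (d mod int n)) mod int n = 0" by (simp add: mod_mult_right_eq)
  then have "int ((2 * nat (d mod int n)) mod n) = 0" using n_pos by (simp add: zmod_int)
  then have "(2 * nat (d mod int n)) mod n = (2 * 0) mod n" by simp
  then show False using no_half_turn assms unfolding D_def cyc_vertex_def by fastforce
qed

text \<open>Since \<open>d\<close> and \<open>d'\<close> commute, the indices \<open>0\<close>,
  \<open>d\<close>, \<open>d + d'\<close>, \<open>d'\<close> would otherwise form a square.\<close>

lemma same_step_unique:
  assumes "D s s d" "D s s d'"
  shows "v d' s = v d s \<or> v d' s = v (- d) s"
proof (rule ccontr)
  assume ne: "\<not> ?thesis"
  show False
  proof (rule no_square[of "v 0 s" "v d s" "v (d + d') s" "v d' s"])
    \<comment> \<open>Adding \<open>d\<close> turns \<open>- d\<close> into \<open>0\<close> and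
      \<open>d'\<close> into \<open>d + d'\<close>.\<close>
    show "v 0 s \<noteq> v (d + d') s"
      using ne v_add_eq_iff[of d "- d" s d' s] by auto
  qed (use assms ne D_sym in \<open>auto simp: E_iff\<close>)
qed

lemma mixed_step_cases:
  assumes "D s (\<not> s) t"
  obtains t' where "t' \<in> mixed_steps s" "v t' = v t"
proof
  show "v (t mod int n) = v t" by (auto simp: cyc_vertex_def)
  then show "t mod int n \<in> mixed_steps s"
    using assms n_pos by (simp add: mixed_steps_def D_def)
qed

lemma inj_mixed: "inj_on (\<lambda>t. v (i + t) s') (mixed_steps s)"
proof (rule inj_onI)
  fix t t' assume *: "t \<in> mixed_steps s" "t' \<in> mixed_steps s" "v (i + t) s' = v (i + t') s'"
  then have "v t s' = v t' s'" using v_add_eq_iff by blast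
  then show "t = t'" using *(1,2) by (simp add: mixed_steps_def v_eq_iff)
qed

lemma mixed_neighbours:
  "{q. E (v i s) q \<and> snd q \<noteq> s} = (\<lambda>t. v (i + t) (\<not> s)) ` mixed_steps s"
proof -
  have "q \<in> (\<lambda>t. v (i + t) (\<not> s)) ` mixed_steps s" if q: "E (v i s) q"
    "snd q \<noteq> s" for q
  proof -
    define j where "j = int (fst q)"
    have qv: "q = v j (\<not> s)"
      using v_of_fst[of q] E_dom[OF E_sym[OF q(1)]] q(2) j_def by (cases "snd q"; cases s) auto
    then have "D s (\<not> s) (j - i)" using q(1) E_iff by simp
    then obtain t' where t': "t' \<in> mixed_steps s" "v t' = v (j - i)" by (rule mixed_step_cases)
    have "v (i + t') (\<not> s) = v (i + (j - i)) (\<not> s)" unfolding v_add_eq_iff using t'(2)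
      by simp
    then show ?thesis using t'(1) qv by (intro image_eqI[of _ _ t']) simp_all
  qed
  moreover have "E (v i s) (v (i + t) (\<not> s)) \<and> snd (v (i + t) (\<not> s)) \<noteq> s"
    if "t \<in> mixed_steps s" for t
    using that by (simp add: E_iff mixed_steps_def) (simp add: cyc_vertex_def)
  ultimately show ?thesis by (intro equalityI subsetI) auto
qed

lemma card_mixed_neighbours: "card {q. E (v i s) q \<and> snd q \<noteq> s} = card (mixed_steps s)"
  unfolding mixed_neighbours by (rule card_image[OF inj_mixed])

text \<open>Symmetry supplies the step \<open>- d\<close> besides \<open>d\<close>, and
  \<open>same_step_unique\<close> leaves no others.\<close>

lemma same_neighbours:
  assumes "D s s d"
  shows "{q. E (v i s) q \<and> snd q = s} = {v (i + d) s, v (i - d) s}"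
proof -
  have "q \<in> {v (i + d) s, v (i - d) s}" if q: "E (v i s) q" "snd q = s" for q
  proof -
    define j where "j = int (fst q)"
    have qv: "q = v j s"
      using v_of_fst[of q] E_dom[OF E_sym[OF q(1)]] q(2) j_def by auto
    then have "D s s (j - i)" using q(1) E_iff by simp
    from same_step_unique[OF assms this]
    have "v (i + (j - i)) s = v (i + d) s \<or> v (i + (j - i)) s = v (i + - d) s"
      unfolding v_add_eq_iff .
    then show ?thesis using qv by simp
  qed
  moreover have "E (v i s) (v (i + d) s)" "E (v i s) (v (i - d) s)" 
    using assms D_sym by (auto simp: E_iff)
  moreover have "snd (v t s) = s" for t by (simp add: cyc_vertex_def)
  ultimately show ?thesis by (intro equalityI subsetI) auto
qed

text \<open>\<open>no_half_step\<close> keeps the two neighbours apart; this is how orientability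
  enters the degrees.\<close>

lemma card_same_neighbours:
  assumes "D s s d"
  shows "card {q. E (v i s) q \<and> snd q = s} = 2"
proof -
  have "v (i + d) s \<noteq> v (i + - d) s"
    unfolding v_add_eq_iff using no_half_step[OF assms] .
  then show ?thesis unfolding same_neighbours[OF assms] by simp
qed

lemma card_neighbours:
  "card {q. E p q} = card {q. E p q \<and> snd q = s} + card {q. E p q \<and> snd q \<noteq> s}"
proof -
  have "card ({q. E p q \<and> snd q = s} \<union> {q. E p q \<and> snd q \<noteq> s})
    = card {q. E p q \<and> snd q = s} + card {q. E p q \<and> snd q \<noteq> s}"
    by (rule card_Un_disjoint) (auto intro: finite_subset[OF _ finite_neighbours[of p]])
  also have "{q. E p q \<and> snd q = s} \<union> {q. E p q \<and> snd q \<noteq> s} = {q. E p q}"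
    by blast
  finally show ?thesis .
qed

lemma degree_with_same:
  assumes "D s s d"
  shows "card {q. E (v i s) q} = 2 + card (mixed_steps s)"
  using card_neighbours[of "v i s" s] card_same_neighbours[OF assms] card_mixed_neighbours by simp

text \<open>Traversing an edge backwards negates its step, and negation modulo \<open>n\<close> is
  injective. The opposite inequality is the same lemma for the other copy.\<close>

lemma card_mixed_le: "card (mixed_steps s) \<le> card (mixed_steps (\<not> s))"
proof -
  have "(\<lambda>t. (- t) mod int n) ` mixed_steps s \<subseteq> mixed_steps (\<not> s)"
  proof (clarify)
    fix t assume "t \<in> mixed_steps s"
    then have "D (\<not> s) (\<not> \<not> s) (- t)" using D_sym[of s "\<not> s" t]
      by (simp add: mixed_steps_def)
    moreover have "v ((- t) mod int n) (\<not> \<not> s) = v (- t) (\<not> \<not> s)"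
      by (simp add: cyc_vertex_def)
    ultimately have "D (\<not> s) (\<not> \<not> s) ((- t) mod int n)" using D_cong by blast
    then show "(- t) mod int n \<in> mixed_steps (\<not> s)"
      using n_pos by (simp add: mixed_steps_def)
  qed
  moreover have "inj_on (\<lambda>t. (- t) mod int n) (mixed_steps s)"
  proof (rule inj_onI)
    fix t t' assume a: "t \<in> mixed_steps s" "t' \<in> mixed_steps s"
      "(- t) mod int n = (- t') mod int n"
    have "t mod int n = t' mod int n" using a(3) by (metis minus_minus mod_minus_eq)
    then show "t = t'" using a by (simp add: mixed_steps_def)
  qed
  moreover have "finite (mixed_steps (\<not> s))"
    by (rule finite_subset[of _ "{0..<int n}"]) (auto simp: mixed_steps_def)
  ultimately show ?thesis by (metis card_inj_on_le)
qed

lemma card_mixed_eq: "card (mixed_steps s) = card (mixed_steps s')"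
  using card_mixed_le[of s] card_mixed_le[of "\<not> s"] by (cases "s = s'") auto

section \<open>Short closed walks from commuting steps\<close>

lemma mixed_ne: "a \<in> mixed_steps s \<Longrightarrow> b \<in> mixed_steps s \<Longrightarrow> a \<noteq> b \<Longrightarrow> v a s' \<noteq> v b s'"
  by (auto simp: mixed_steps_def v_eq_iff)

lemma mixed_D: "a \<in> mixed_steps True \<Longrightarrow> D True False a"
  "a \<in> mixed_steps True \<Longrightarrow> D False True (- a)"
  using D_sym[of True False a] by (auto simp: mixed_steps_def)

lemma mixed_diff_ne:
  "a \<in> mixed_steps s \<Longrightarrow> b \<in> mixed_steps s \<Longrightarrow> a \<noteq> b \<Longrightarrow> v (a - b) s' \<noteq> v 0 s'"
  using mixed_ne[of a s b s'] v_add_eq_iff[of b "a - b" s' 0 s'] by simp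

lemma v_sign_ne [simp]: "s \<noteq> s' \<Longrightarrow> v a s \<noteq> v b s'"
  by (simp add: cyc_vertex_def)

text \<open>The steps \<open>d\<close>, \<open>a\<close>, \<open>- b\<close>, \<open>- d\<close>,
  \<open>b\<close>, \<open>- a\<close> sum to zero and trace a hexagon. Entries two apart have
  different signs or differ by \<open>a - b\<close>.\<close>

lemma mixed_same_two:
  assumes d: "D True True d" and a: "a \<in> mixed_steps True" and b: "b \<in> mixed_steps True"
    and "a \<noteq> b"
  shows "m \<le> 3"
proof (rule hexagon_m_le)
  let ?c = "v (a - b) True"
  show "E (v 0 True) (v d True)" "E (v d True) (v (d + a) False)"
    "E (v (d + a) False) (v (d + (a - b)) True)" "E (v (d + (a - b)) True) ?c"
    "E ?c (v a False)" "E (v a False) (v 0 True)"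
    using d D_sym[OF d] mixed_D[OF a] mixed_D[OF b] by (auto simp: E_iff)
  show "v d True \<noteq> v (d + (a - b)) True" "?c \<noteq> v 0 True"
    using mixed_diff_ne[OF a b \<open>a \<noteq> b\<close>, of True]
      v_add_eq_iff[of d 0 True "a - b" True] by auto
qed auto

text \<open>The octagon has steps \<open>d\<close>, \<open>a\<close>, \<open>e\<close>,
  \<open>- a\<close>, \<open>- d\<close>, \<open>a\<close>, \<open>- e\<close>, \<open>- a\<close>.
  Its vertices come in pairs of equal sign, the pairs alternating, so entries two apart always
  differ in sign.\<close>

lemma mixed_both:
  assumes d: "D True True d" and e: "D False False e" and a: "a \<in> mixed_steps True"
  shows "m \<le> 4"
proof (rule octagon_m_le)
  show "E (v 0 True) (v d True)" "E (v d True) (v (d + a) False)"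
    "E (v (d + a) False) (v (d + a + e) False)" "E (v (d + a + e) False) (v (d + e) True)"
    "E (v (d + e) True) (v e True)" "E (v e True) (v (e + a) False)"
    "E (v (e + a) False) (v a False)" "E (v a False) (v 0 True)"
    using d e D_sym[OF d] D_sym[OF e] mixed_D[OF a] by (auto simp: E_iff)
qed auto

text \<open>The hexagon has steps \<open>a\<close>, \<open>- b\<close>, \<open>c\<close>,
  \<open>- a\<close>, \<open>b\<close>, \<open>- c\<close>. Entries two apart differ by a difference
  of two of the three steps, up to sign.\<close>

lemma mixed_three:
  assumes a: "a \<in> mixed_steps True" and b: "b \<in> mixed_steps True"
    and c: "c \<in> mixed_steps True"
    and ne: "a \<noteq> b" "b \<noteq> c" "a \<noteq> c"
  shows "m \<le> 3"
proof (rule hexagon_m_le)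
  show "E (v 0 True) (v a False)" "E (v a False) (v (a - b) True)"
    "E (v (a - b) True) (v (a - b + c) False)" "E (v (a - b + c) False) (v (c - b) True)"
    "E (v (c - b) True) (v c False)" "E (v c False) (v 0 True)"
    using mixed_D[OF a] mixed_D[OF b] mixed_D[OF c] by (auto simp: E_iff)
  show "v 0 True \<noteq> v (a - b) True" "v (c - b) True \<noteq> v 0 True"
    using mixed_diff_ne[OF a b ne(1), of True]
      mixed_diff_ne[OF c b ne(2)[symmetric], of True] by simp_all
  show "v a False \<noteq> v (a - b + c) False"
    using mixed_diff_ne[OF c b ne(2)[symmetric], of False] v_add_eq_iff[of a 0 False "c - b" False]
    by (auto simp: algebra_simps)
  show "v (a - b) True \<noteq> v (c - b) True"
    using mixed_ne[OF a c ne(3)] v_add_eq_iff[of "- b" a True c True] by auto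
  show "v (a - b + c) False \<noteq> v c False"
    using mixed_diff_ne[OF a b ne(1), of False] v_add_eq_iff[of c "a - b" False 0 False]
    by (auto simp: algebra_simps)
qed

text \<open>All neighbours of a generator now lie in the other copy, so the degree bound yields
  three mixed steps.\<close>

lemma m_le_3_of_no_same:
  assumes "\<And>i j. \<not> E (i, True) (j, True)"
  shows "m \<le> 3"
proof -
  have "\<not> (E (v 0 True) q \<and> snd q = True)" for q
    using assms[of "fst (v 0 True)" "fst q"] by (metis cyc_vertex_def prod.collapse snd_conv)
  then have "card {q. E (v 0 True) q \<and> snd q = True} = 0"
    by (metis (no_types, lifting) card.empty empty_Collect_eq)
  then have "3 \<le> card (mixed_steps True)"
    using card_neighbours[of "v 0 True" True] degree[OF fst_v, of 0 True]
      card_mixed_neighbours[of 0 True] by simp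
  then obtain U where "U \<subseteq> mixed_steps True" "card U = 3"
    by (rule obtain_subset_with_card_n)
  then obtain a b c where "a \<in> mixed_steps True" "b \<in> mixed_steps True"
    "c \<in> mixed_steps True"
    "a \<noteq> b" "b \<noteq> c" "a \<noteq> c" by (auto simp: card_3_iff)
  then show ?thesis by (rule mixed_three)
qed

end

locale cyclic_polygon = cyclic_graph E m n + bipartite_polygon E m S T
  for E :: "nat letter \<Rightarrow> nat letter \<Rightarrow> bool" and m n S T +
  assumes S_T_dom: "S \<union> T \<subseteq> {..<n} \<times> UNIV"
    and S_nonempty: "S \<noteq> {}"
begin

section \<open>Parity of the sides\<close>

lemma finite_sides: "finite S" "finite T"
  using S_T_dom finite_subset[of _ "{..<n} \<times> (UNIV :: bool set)"] by auto

lemma in_sides_v: "p \<in> S \<union> T \<Longrightarrow> p = v (int (fst p)) (snd p)"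
  using S_T_dom by (intro v_of_fst) auto

text \<open>Translation by \<open>t\<close> moves each vertex along an edge, hence to the other
  side, and is injective. The disjunction on \<open>(A, B)\<close> lets one statement serve both
  directions.\<close>

lemma card_step_le:
  assumes "D s s' t" and "(A, B) = (S, T) \<or> (A, B) = (T, S)"
  shows "card {p \<in> A. snd p = s} \<le> card {p \<in> B. snd p = s'}"
proof (rule card_inj_on_le)
  let ?f = "\<lambda>p :: nat letter. v (int (fst p) + t) s'"
  have *: "p = v (int (fst p)) s" if "p \<in> A" "snd p = s" for p
    using that in_sides_v[of p] assms(2) by auto
  show "inj_on ?f {p \<in> A. snd p = s}"
  proof (rule inj_onI)
    fix p q assume pq: "p \<in> {p \<in> A. snd p = s}" "q \<in> {p \<in> A. snd p = s}"
      and "?f p = ?f q"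
    then have "v (t + int (fst p)) s' = v (t + int (fst q)) s'" by (simp add: add.commute)
    then have "v (int (fst p)) s = v (int (fst q)) s" unfolding v_add_eq_iff by (simp add: v_eq_iff)
    then show "p = q" using *[of p] *[of q] pq by simp
  qed
  show "?f ` {p \<in> A. snd p = s} \<subseteq> {p \<in> B. snd p = s'}"
  proof (rule image_subsetI)
    fix p assume p: "p \<in> {p \<in> A. snd p = s}"
    have "E (v (int (fst p)) s) (?f p)" using assms(1) by (simp add: E_iff)
    then have "E p (?f p)" using *[of p] p by simp
    then have "?f p \<in> B" using p assms(2) S_to_T T_to_S by blast
    then show "?f p \<in> {p \<in> B. snd p = s'}" by (simp add: cyc_vertex_def)
  qed
  show "finite {p \<in> B. snd p = s'}" using assms(2) finite_sides by auto
qed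

lemma no_both_same_signs:
  assumes "E (i, True) (j, True)" "E (i', False) (j', False)"
  shows False
proof -
  have lt: "i < n" "j < n" "i' < n" "j' < n"
    using assms E_dom E_sym by fastforce+
  obtain d where d: "D True True d"
    using assms(1) v_of_fst[of "(i, True)"] v_of_fst[of "(j, True)"] lt
      E_iff[of "int i" True "int j" True] by auto
  obtain e where e: "D False False e"
    using assms(2) v_of_fst[of "(i', False)"] v_of_fst[of "(j', False)"] lt
      E_iff[of "int i'" False "int j'" False] by auto
  define \<beta> where "\<beta> = card (mixed_steps True)"
  have deg: "card {q. E p q} = 2 + \<beta>" if "fst p < n" for p
  proof (cases "snd p")
    case True
    then show ?thesis using degree_with_same[OF d, of "int (fst p)"] v_of_fst[OF that] \<beta>_def
      by simp
  next
    case False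
    then show ?thesis
      using degree_with_same[OF e, of "int (fst p)"] v_of_fst[OF that] \<beta>_def
        card_mixed_eq[of True False] by simp
  qed
  have "1 \<le> \<beta>" using degree[OF fst_v, of 0 True] deg[OF fst_v, of 0 True] by simp
  then obtain b where b: "b \<in> mixed_steps True" unfolding \<beta>_def
    by (metis card.empty equals0I not_one_le_zero)
  have degST: "card {q. E p q} = 2 + \<beta>" if "p \<in> S \<union> T" for p
    using deg that S_T_dom by auto
  obtain p where p: "p \<in> S" using S_nonempty by blast
  \<comment> \<open>Two mixed steps give a hexagon; a single one leaves only the octagon.\<close>
  have "m = 3 \<or> m = 4 \<and> \<beta> = 1"
  proof (cases "\<beta> = 1")
    case True
    then show ?thesis using mixed_both[OF d e b] m_ge by auto
  next
    case False
    then have "mixed_steps True \<noteq> {b}" using \<beta>_def by auto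
    then obtain c where "c \<in> mixed_steps True" "c \<noteq> b" using b by blast
    then show ?thesis using mixed_same_two[OF d _ b] m_ge by simp
  qed
  moreover
  \<comment> \<open>The step \<open>d\<close> matches the generators of the two sides, and the mixed
    step \<open>b\<close> matches the generators of one side with the inverses of the other.\<close>
  have halves: "card A = 2 * card {p \<in> A. snd p}" if A: "(A, B) = (S, T) \<or> (A, B) = (T, S)"
    for A B
  proof -
    have A': "(B, A) = (S, T) \<or> (B, A) = (T, S)" using A by auto
    have "card {p \<in> A. snd p = True} = card {p \<in> B. snd p = True}"
      using card_step_le[OF d A] card_step_le[OF d A'] by simp
    also have "\<dots> = card {p \<in> A. snd p = False}"
      using card_step_le[OF mixed_D(1)[OF b] A'] card_step_le[OF mixed_D(2)[OF b] A] by simp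
    finally have "card {p \<in> A. snd p} = card {p \<in> A. \<not> snd p}" by simp
    moreover have "card ({p \<in> A. snd p} \<union> {p \<in> A. \<not> snd p}) = card {p \<in> A. snd p} + card {p \<in> A. \<not> snd p}"
      using A finite_sides by (intro card_Un_disjoint) auto
    moreover have "{p \<in> A. snd p} \<union> {p \<in> A. \<not> snd p} = A" by blast
    ultimately show ?thesis by simp
  qed
  ultimately show False
  proof (elim disjE conjE)
    assume "m = 3"
    \<comment> \<open>One plus a product of consecutive numbers is odd.\<close>
    then have "card S = 1 + (2 + \<beta>) * (2 + \<beta> - 1)" using card_side_3 p degST by blast
    moreover have "even (card S)" using halves[of S T] by simp
    ultimately show False by simp
  next
    assume "m = 4" "\<beta> = 1"
    \<comment> \<open>The degree is three here, so \<open>T\<close> has 15 vertices.\<close>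
    then have "card T = 3 + 3 * 2\<^sup>2" using card_side_4[of p "2 + \<beta>"] p degST by simp
    moreover have "even (card T)" using halves[of T S] by simp
    ultimately show False by simp
  qed
qed

end

section \<open>Cyclic permutations and shifts of words\<close>

lemma inv_letter_inv [simp]: "inv_letter (inv_letter a) = a"
  by (simp add: inv_letter_def)

lemma inv_word_inv [simp]: "inv_word (inv_word w) = w"
  by (simp add: inv_word_def rev_map comp_def)

lemma inv_word_append: "inv_word (u @ v) = inv_word v @ inv_word u"
  by (simp add: inv_word_def)

lemma length_inv_word [simp]: "length (inv_word w) = length w"
  by (simp add: inv_word_def)

lemma word_over_inv [simp]: "word_over X (inv_word w) \<longleftrightarrow> word_over X w"
  by (simp add: word_over_def inv_word_def image_image inv_letter_def)

text \<open>The split form passes directly through \<open>map\<close> and inversion, where a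
  rotation count would have to be tracked.\<close>

lemma cyclic_permutation_iff: "cyclic_permutation u v \<longleftrightarrow> (\<exists>a b. u = b @ a \<and> v = a @ b)"
proof
  assume "cyclic_permutation u v"
  then obtain j where "u = rotate j v" by (auto simp: cyclic_permutation_def)
  then have "u = drop (j mod length v) v @ take (j mod length v) v" by (simp add: rotate_drop_take)
  then show "\<exists>a b. u = b @ a \<and> v = a @ b" by (metis append_take_drop_id)
next
  assume "\<exists>a b. u = b @ a \<and> v = a @ b"
  then show "cyclic_permutation u v" by (metis cyclic_permutation_def rotate_append)
qed

lemma cyclic_permutation_sym: "cyclic_permutation u v \<Longrightarrow> cyclic_permutation v u"
  by (auto simp: cyclic_permutation_iff)

lemma cyclic_permutation_trans:
  "cyclic_permutation u v \<Longrightarrow> cyclic_permutation v w \<Longrightarrow> cyclic_permutation u w"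
  unfolding cyclic_permutation_def by (metis rotate_rotate)

lemma cyclic_permutation_inv:
  "cyclic_permutation u v \<Longrightarrow> cyclic_permutation (inv_word u) (inv_word v)"
  unfolding cyclic_permutation_iff by (metis inv_word_append)

lemma cyclic_permutation_set: "cyclic_permutation u v \<Longrightarrow> set u = set v"
  by (auto simp: cyclic_permutation_def)

lemma cyclic_permutation_shift:
  "cyclic_permutation u v \<Longrightarrow> cyclic_permutation ((shift n ^^ t) u) ((shift n ^^ t) v)"
proof (induction t)
  case (Suc t)
  have "cyclic_permutation (shift n u) (shift n v)" if "cyclic_permutation u v" for u v
    using that unfolding cyclic_permutation_iff shift_def by (metis map_append)
  then show ?case using Suc by simp
qed simp

lemma inv_word_shift: "inv_word ((shift n ^^ t) w) = (shift n ^^ t) (inv_word w)"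
proof -
  have "inv_word (shift n w) = shift n (inv_word w)" for w
    by (auto simp: inv_word_def shift_def rev_map inv_letter_def)
  then show ?thesis by (induction t) simp_all
qed

text \<open>The formula reduces indices already at \<open>t = 0\<close>, where it is the identity
  because all letters are below \<open>n\<close>.\<close>

lemma shift_power:
  assumes "word_over {..<n} w"
  shows "(shift n ^^ t) w = map (\<lambda>(x, s). ((x + t) mod n, s)) w"
proof (induction t)
  case 0
  have "map (\<lambda>(x, s). (x mod n, s)) w = map id w"
    using assms by (intro map_cong) (auto simp: word_over_def)
  then show ?case by simp
next
  case (Suc t)
  then show ?case by (auto simp: shift_def mod_Suc_eq)
qed

text \<open>The shift has order dividing \<open>n\<close> on such words, which removes the bound
  \<open>i < n\<close> from \<open>cyclic_relators\<close>.\<close>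

lemma shift_power_mod:
  "word_over {..<n} w \<Longrightarrow> (shift n ^^ (t mod n)) w = (shift n ^^ t) w"
  by (auto simp: shift_power mod_add_right_eq)

lemma shift_power_add: "(shift n ^^ s) ((shift n ^^ t) w) = (shift n ^^ (s + t)) w"
  by (simp add: funpow_add)

lemma length_shift_power [simp]: "length ((shift n ^^ t) w) = length w"
  by (induction t) (simp_all add: shift_def)

lemma word_over_shift: "0 < n \<Longrightarrow> word_over {..<n} w \<Longrightarrow> word_over {..<n} ((shift n ^^ t) w)"
  by (auto simp: shift_power word_over_def)

lemma snd_set_shift: "snd ` set ((shift n ^^ t) w) = snd ` set w"
proof (induction t)
  case (Suc t)
  then show ?case by (force simp: shift_def image_image split_beta)
qed simp

section \<open>Symmetrized relators of a cyclic presentation\<close>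

lemma symmetrized_iff:
  "u \<in> symmetrized R \<longleftrightarrow> (\<exists>r\<in>R. cyclic_permutation u r \<or> cyclic_permutation u (inv_word r))"
  by (auto simp: symmetrized_def)

lemma symmetrized_cyclic: "u \<in> symmetrized R \<Longrightarrow> cyclic_permutation v u \<Longrightarrow> v \<in> symmetrized R"
  by (meson cyclic_permutation_trans symmetrized_iff)

lemma symmetrized_inv: "u \<in> symmetrized R \<Longrightarrow> inv_word u \<in> symmetrized R"
  by (metis cyclic_permutation_inv inv_word_inv symmetrized_iff)

lemma symmetrized_cyclic_relators_iff:
  assumes "0 < n" "word_over {..<n} w"
  shows "u \<in> symmetrized (cyclic_relators n w) \<longleftrightarrow>
    (\<exists>i. cyclic_permutation u ((shift n ^^ i) w) \<or> cyclic_permutation u ((shift n ^^ i) (inv_word w)))"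
proof -
  have "cyclic_relators n w = range (\<lambda>i. (shift n ^^ i) w)"
  proof
    have "(shift n ^^ i) w \<in> cyclic_relators n w" for i
      unfolding cyclic_relators_def using assms(1) shift_power_mod[OF assms(2), of i]
      by (intro CollectI exI[of _ "i mod n"]) simp
    then show "range (\<lambda>i. (shift n ^^ i) w) \<subseteq> cyclic_relators n w" by blast
  qed (auto simp: cyclic_relators_def)
  then show ?thesis by (simp add: symmetrized_iff inv_word_shift)
qed

lemma symmetrized_shift:
  assumes "0 < n" "word_over {..<n} w" "u \<in> symmetrized (cyclic_relators n w)"
  shows "(shift n ^^ t) u \<in> symmetrized (cyclic_relators n w)"
proof -
  obtain i
    where "cyclic_permutation u ((shift n ^^ i) w) \<or> cyclic_permutation u ((shift n ^^ i) (inv_word w))"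
    using assms(3) unfolding symmetrized_cyclic_relators_iff[OF assms(1,2)] by blast
  then show ?thesis
    unfolding symmetrized_cyclic_relators_iff[OF assms(1,2)]
    using cyclic_permutation_shift[where n = n and t = t] shift_power_add by metis
qed

text \<open>Extends orientability from \<open>w\<close> to every symmetrized word. Such a word is a
  rotation of a shift of \<open>w\<close> or of its inverse, and either case relates one shift of
  \<open>w\<close> to the inverse of another.\<close>

lemma orientable_no_reversal:
  assumes "0 < n" "word_over {..<n} w" "orientable n w" "u \<in> symmetrized (cyclic_relators n w)"
  shows "\<not> cyclic_permutation u (inv_word ((shift n ^^ t) u))"
proof
  assume u: "cyclic_permutation u (inv_word ((shift n ^^ t) u))"
  have *: False if "cyclic_permutation ((shift n ^^ i) w) (inv_word ((shift n ^^ j) w))" for i j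
  proof -
    \<comment> \<open>Shifting \<open>n * i - i\<close> more times raises the exponent
      \<open>i\<close> to \<open>n * i\<close>, which acts as the identity on \<open>w\<close>. The
      subtraction is exact because \<open>n\<close> is positive.\<close>
    let ?l = "n * i - i"
    have "cyclic_permutation ((shift n ^^ (?l + i)) w) (inv_word ((shift n ^^ (?l + j)) w))"
      using cyclic_permutation_shift[OF that, where n = n and t = ?l]
      unfolding inv_word_shift shift_power_add .
    moreover have "?l + i = n * i" using assms(1) by (cases n) auto
    moreover have "(shift n ^^ (n * i)) w = w" using shift_power_mod[OF assms(2), of "n * i"]
      by simp
    moreover have "(shift n ^^ (?l + j)) w = (shift n ^^ ((?l + j) mod n)) w"
      using shift_power_mod[OF assms(2)] by simp
    ultimately show False using assms(1,3) by (auto simp: orientable_def)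
  qed
  from assms(4) obtain i where "cyclic_permutation u ((shift n ^^ i) w) \<or>
      cyclic_permutation u (inv_word ((shift n ^^ i) w))"
    unfolding symmetrized_cyclic_relators_iff[OF assms(1,2)] by (auto simp: inv_word_shift)
  then show False
  proof
    assume i: "cyclic_permutation u ((shift n ^^ i) w)"
    have "cyclic_permutation (inv_word ((shift n ^^ t) u)) (inv_word ((shift n ^^ (t + i)) w))"
      using cyclic_permutation_inv[OF cyclic_permutation_shift[OF i, where n = n and t = t]]
        by (simp add: shift_power_add)
    then show False using * i u cyclic_permutation_sym cyclic_permutation_trans by metis
  next
    assume i: "cyclic_permutation u (inv_word ((shift n ^^ i) w))"
    have "cyclic_permutation (inv_word ((shift n ^^ t) u)) ((shift n ^^ (t + i)) w)"
      using cyclic_permutation_inv[OF cyclic_permutation_shift[OF i, where n = n and t = t]]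
      by (simp add: shift_power_add inv_word_shift)
    then show False using * i u cyclic_permutation_sym cyclic_permutation_trans by metis
  qed
qed

text \<open>For \<open>u = a # b # z\<close> the inverse ends with the inverted letters of
  \<open>b\<close> and \<open>a\<close>; \<open>star_rev\<close> rotates these two to the
  front.\<close>

lemma star_rev_cyclic: "2 \<le> length u \<Longrightarrow> cyclic_permutation (star_rev u) (inv_word u)"
proof (cases u rule: star_rev.cases)
  case (1 a b z)
  then show ?thesis unfolding cyclic_permutation_iff
    by (intro exI[of _ "inv_word z"] exI[of _ "[inv_letter b, inv_letter a]"]) (simp add: inv_word_def)
qed auto

lemma length_star_rev [simp]: "length (star_rev u) = length u"
  by (cases u rule: star_rev.cases) simp_all

lemma star_rev_star_rev: "2 \<le> length u \<Longrightarrow> star_rev (star_rev u) = u"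
  by (cases u rule: star_rev.cases) simp_all

lemma star_rev_ends:
  assumes "2 \<le> length u"
  shows "star_rev u ! 0 = inv_letter (u ! 1)" "inv_letter (star_rev u ! 1) = u ! 0"
  using assms by (cases u rule: star_rev.cases; simp)+

lemma symmetrized_star_rev:
  "u \<in> symmetrized R \<Longrightarrow> 2 \<le> length u \<Longrightarrow> star_rev u \<in> symmetrized R"
  using symmetrized_cyclic symmetrized_inv star_rev_cyclic by blast

section \<open>Components of reversible digraphs\<close>

locale reversible_digraph = wf_digraph G for G :: "('a, 'b) pre_digraph" +
  fixes rv :: "'b \<Rightarrow> 'b"
  assumes rv_arc: "e \<in> arcs G \<Longrightarrow> rv e \<in> arcs G"
    and rv_ends: "e \<in> arcs G \<Longrightarrow> tail G (rv e) = head G e"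
      "e \<in> arcs G \<Longrightarrow> head G (rv e) = tail G e"
    and rv_rv: "e \<in> arcs G \<Longrightarrow> rv (rv e) = e"
begin

lemma dominates_iff: "p \<rightarrow>\<^bsub>G\<^esub> q \<longleftrightarrow> (\<exists>e\<in>arcs G. tail G e = p \<and> head G e = q)"
  by (auto simp: arcs_ends_def arc_to_ends_def)

lemma dominates_sym: "p \<rightarrow>\<^bsub>G\<^esub> q \<Longrightarrow> q \<rightarrow>\<^bsub>G\<^esub> p"
  unfolding dominates_iff using rv_arc rv_ends by blast

sublocale sym_digraph
  by unfold_locales (auto simp: symmetric_def intro: symI dominates_sym)

text \<open>As adjacency is symmetric, the vertices reachable from \<open>p\<close> form its strong
  component.\<close>

definition component :: "'a \<Rightarrow> ('a, 'b) pre_digraph" where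
  "component p = G \<restriction> {q. p \<rightarrow>\<^sup>*\<^bsub>G\<^esub> q}"

lemma component_in_sccs: "p \<in> verts G \<Longrightarrow> component p \<in> sccs"
  unfolding component_def by (rule induce_reachable_is_in_sccs)

lemma component_sel:
  "verts (component p) = {q. p \<rightarrow>\<^sup>*\<^bsub>G\<^esub> q}"
    "tail (component p) = tail G" "head (component p) = head G"
  "arcs (component p) = {e \<in> arcs G. p \<rightarrow>\<^sup>*\<^bsub>G\<^esub> tail G e}"
proof -
  have "p \<rightarrow>\<^sup>*\<^bsub>G\<^esub> head G e" if "e \<in> arcs G"
    "p \<rightarrow>\<^sup>*\<^bsub>G\<^esub> tail G e" for e
    using that by (meson dominates_iff reachable_adj_trans)
  then show "arcs (component p) = {e \<in> arcs G. p \<rightarrow>\<^sup>*\<^bsub>G\<^esub> tail G e}"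
    by (auto simp: component_def induce_subgraph_def)
qed (simp_all add: component_def)

lemma wf_component: "wf_digraph (component p)"
  unfolding component_def by (rule wellformed_induce_subgraph)

lemma awalk_component:
  "awalk u es v \<Longrightarrow> p \<rightarrow>\<^sup>*\<^bsub>G\<^esub> u \<Longrightarrow> pre_digraph.awalk (component p) u es v"
proof (induction es arbitrary: u)
  case Nil
  then show ?case
    by (simp add: wf_digraph.awalk_Nil_iff[OF wf_component] awalk_Nil_iff component_sel)
next
  case (Cons e es)
  then have "e \<in> arcs G" "u = tail G e" "awalk (head G e) es v"
    by (simp_all add: awalk_Cons_iff)
  moreover from this Cons.prems have "p \<rightarrow>\<^sup>*\<^bsub>G\<^esub> head G e"
    by (meson dominates_iff reachable_adj_trans)
  ultimately show ?case using Cons.IH Cons.prems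
    by (simp add: wf_digraph.awalk_Cons_iff[OF wf_component] component_sel)
qed

lemma out_arcs_component: "p \<in> verts G \<Longrightarrow> out_arcs (component p) p = out_arcs G p"
  by (auto simp: out_arcs_def component_sel)

text \<open>A closed walk stays in the component of its base point, so the girth of the components
  bounds closed walks of the whole graph.\<close>

lemma reduced_closed_walk_length:
  assumes "\<forall>C\<in>sccs. girth rv C = enat g" "awalk u es u" "reduced_path rv es"
    "es \<noteq> []"
  shows "g \<le> length es"
proof -
  have u: "u \<in> verts G" using assms(2) by auto
  then have "pre_digraph.awalk (component u) u es u" using awalk_component[OF assms(2)] by simp
  then have "girth rv (component u) \<le> enat (length es)"
    unfolding girth_def using assms(3,4) by (intro INF_lower) blast
  then show ?thesis using assms(1) component_in_sccs[OF u] by simp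
qed

text \<open>An arc is chosen for every adjacency. If the next arc were the reverse of the current
  one, the list would return to \<open>u\<close> at once; the clause on \<open>hd es\<close> makes
  this visible in the induction.\<close>

lemma nb_walk_arcs:
  assumes "nb_walk (\<lambda>p q. p \<rightarrow>\<^bsub>G\<^esub> q) (u # vs)" "u \<in> verts G"
  shows "\<exists>es. awalk u es (last (u # vs)) \<and> reduced_path rv es \<and> length es = length vs \<and>
    (vs \<noteq> [] \<longrightarrow> head G (hd es) = hd vs)"
  using assms
proof (induction vs arbitrary: u)
  case Nil
  then show ?case by (intro exI[of _ "[]"]) (simp add: awalk_Nil_iff reduced_path_def)
next
  case (Cons v vs)
  then have "u \<rightarrow>\<^bsub>G\<^esub> v" by (simp add: nb_walk_def)
  then obtain e where e: "e \<in> arcs G" "tail G e = u" "head G e = v"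
    by (auto simp: dominates_iff)
  have "nb_walk (\<lambda>p q. p \<rightarrow>\<^bsub>G\<^esub> q) (v # vs)"
    using Cons.prems by (cases vs) (simp_all add: nb_walk_def)
  from Cons.IH[OF this] e obtain es where es: "awalk v es (last (v # vs))" "reduced_path rv es"
    "length es = length vs" "vs \<noteq> [] \<longrightarrow> head G (hd es) = hd vs" by auto
  have "awalk u (e # es) (last (u # v # vs))" using e es(1) by (simp add: awalk_Cons_iff)
  moreover have "reduced_path rv (e # es)"
  proof (cases es)
    case (Cons f fs)
    with es(3) obtain y ys where vs: "vs = y # ys" by (cases vs) auto
    then have "head G f = y" "u \<noteq> y" using es(4) Cons Cons.prems(1) vs
      by (auto simp: nb_walk_def)
    then have "f \<noteq> rv e" using rv_ends(2)[OF e(1)] e(2) by auto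
    then show ?thesis using es(2) Cons by (simp add: reduced_path_def)
  qed (simp add: reduced_path_def)
  ultimately show ?case using es(3) e(3) by (intro exI[of _ "e # es"]) auto
qed

lemma nb_walk_length:
  assumes "\<forall>C\<in>sccs. girth rv C = enat g"
    "nb_walk (\<lambda>p q. p \<rightarrow>\<^bsub>G\<^esub> q) vs" "2 \<le> length vs"
    "hd vs = last vs"
  shows "g < length vs"
proof -
  obtain u us where vs: "vs = u # us" "us \<noteq> []" using assms(3) by (cases vs) force+
  then have "u \<rightarrow>\<^bsub>G\<^esub> hd us" using assms(2)
    by (cases us) (simp_all add: nb_walk_def)
  then have "u \<in> verts G" by auto
  from nb_walk_arcs[OF assms(2)[unfolded vs(1)] this] obtain es
    where "awalk u es (last (u # us))" "reduced_path rv es" "length es = length us" by blast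
  moreover have "last (u # us) = u" using assms(4) vs by simp
  ultimately have "g \<le> length es"
    using reduced_closed_walk_length[OF assms(1), of u es] vs(2) by force
  then show ?thesis using vs \<open>length es = length us\<close> by simp
qed

text \<open>Two distinct parallel arcs would give the reduced closed path \<open>e, rv e'\<close> of
  length two.\<close>

lemma no_parallel_arcs:
  assumes "\<forall>C\<in>sccs. girth rv C = enat g" "3 \<le> g" "e \<in> arcs G" "e' \<in> arcs G"
    "tail G e = tail G e'" "head G e = head G e'"
  shows "e = e'"
proof (rule ccontr)
  assume "e \<noteq> e'"
  then have "rv e' \<noteq> rv e" using rv_rv assms(3,4) by metis
  then have "reduced_path rv [e, rv e']" by (simp add: reduced_path_def)
  moreover have "awalk (tail G e) [e, rv e'] (tail G e)"
    using assms rv_arc rv_ends by (simp add: awalk_Cons_iff awalk_Nil_iff)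
  ultimately have "g \<le> length [e, rv e']"
    by (intro reduced_closed_walk_length[OF assms(1)]) simp_all
  then show False using assms(2) by simp
qed

text \<open>Without parallel arcs, the arcs leaving \<open>p\<close> correspond to its neighbours,
  so degrees become neighbour counts.\<close>

lemma card_dominates:
  assumes "\<forall>C\<in>sccs. girth rv C = enat g" "3 \<le> g" "p \<in> verts G"
  shows "card {q. p \<rightarrow>\<^bsub>G\<^esub> q} = out_degree (component p) p"
proof -
  have "{q. p \<rightarrow>\<^bsub>G\<^esub> q} = head G ` out_arcs G p"
    by (auto simp: dominates_iff out_arcs_def)
  moreover have "inj_on (head G) (out_arcs G p)"
    using no_parallel_arcs[OF assms(1,2)] by (auto simp: inj_on_def out_arcs_def)
  ultimately show ?thesis
    using out_arcs_component[OF assms(3)] by (simp add: card_image out_degree_def)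
qed

lemma awalk_component_verts:
  "pre_digraph.awalk (component p) u es v \<Longrightarrow>
    \<exists>vs. successively (\<lambda>p q. p \<rightarrow>\<^bsub>G\<^esub> q) vs \<and> vs \<noteq> [] \<and> hd vs = u \<and> last vs = v \<and> length vs = length es + 1"
proof (induction es arbitrary: u)
  case Nil
  then show ?case
    by (intro exI[of _ "[u]"]) (simp add: wf_digraph.awalk_Nil_iff[OF wf_component])
next
  case (Cons e es)
  then have e: "e \<in> arcs G" "u = tail G e" and "pre_digraph.awalk (component p) (head G e) es v"
    by (simp_all add: wf_digraph.awalk_Cons_iff[OF wf_component] component_sel)
  from Cons.IH[OF this(3)] obtain vs
    where "successively (\<lambda>p q. p \<rightarrow>\<^bsub>G\<^esub> q) vs" "vs \<noteq> []"
    "hd vs = head G e" "last vs = v" "length vs = length es + 1" by blast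
  moreover from e have "u \<rightarrow>\<^bsub>G\<^esub> head G e" by (auto simp: dominates_iff)
  ultimately show ?case by (intro exI[of _ "u # vs"]) (auto simp: successively_Cons)
qed

lemma diameter_walk:
  assumes "diam (component p) = enat m" "u \<in> verts (component p)" "v \<in> verts (component p)"
  shows "\<exists>vs. successively (\<lambda>p q. p \<rightarrow>\<^bsub>G\<^esub> q) vs \<and> vs \<noteq> [] \<and> hd vs = u \<and> last vs = v \<and> length vs \<le> m + 1"
proof -
  let ?P = "{es. pre_digraph.awalk (component p) u es v}"
  have "vdist (component p) u v \<le> diam (component p)"
    unfolding diam_def by (rule SUP_upper2[OF assms(2)], rule SUP_upper[OF assms(3)])
  \<comment> \<open>A strict bound on the infimum yields an actual walk.\<close>
  also have "\<dots> < enat (Suc m)" using assms(1) by simp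
  finally obtain es where es: "es \<in> ?P" "enat (length es) < enat (Suc m)"
    unfolding vdist_def INF_less_iff by blast
  obtain vs where "successively (\<lambda>p q. p \<rightarrow>\<^bsub>G\<^esub> q) vs"
    "vs \<noteq> []" "hd vs = u" "last vs = v"
    "length vs = length es + 1"
    using awalk_component_verts es(1) by blast
  with es(2) show ?thesis by (intro exI[of _ vs]) simp
qed

text \<open>The sides are named so that \<open>S\<close> contains \<open>p\<close>; an edge of
  \<open>G\<close> starting in the component belongs to it.\<close>

lemma bipartite_component:
  assumes "bipartite (component p)" "p \<in> verts G"
  obtains S T where "S \<union> T = verts (component p)" "S \<inter> T = {}" "p \<in> S"
    "\<And>u v. u \<in> S \<Longrightarrow> u \<rightarrow>\<^bsub>G\<^esub> v \<Longrightarrow> v \<in> T" "\<And>u v. u \<in> T \<Longrightarrow> u \<rightarrow>\<^bsub>G\<^esub> v \<Longrightarrow> v \<in> S"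
proof -
  obtain A B where AB: "A \<union> B = verts (component p)" "A \<inter> B = {}"
    "\<forall>e\<in>arcs (component p). tail G e \<in> A \<and> head G e \<in> B \<or> tail G e \<in> B \<and> head G e \<in> A"
    using assms(1) unfolding bipartite_def component_sel(2,3) by blast
  have step: "u \<in> A \<and> v \<in> B \<or> u \<in> B \<and> v \<in> A" if "u \<in> A \<union> B"
    "u \<rightarrow>\<^bsub>G\<^esub> v" for u v
  proof -
    from that(2) obtain e where "e \<in> arcs G" "tail G e = u" "head G e = v"
      by (auto simp: dominates_iff)
    moreover from this that(1) have "e \<in> arcs (component p)" by (simp add: AB(1) component_sel)
    ultimately show ?thesis using AB(3) by blast
  qed
  have "p \<in> A \<union> B" using assms(2) by (simp add: AB(1) component_sel)
  then show thesis
  proof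
    assume "p \<in> A"
    show thesis by (rule that[OF AB(1,2) \<open>p \<in> A\<close>]) (use step AB(2) in blast)+
  next
    assume "p \<in> B"
    show thesis by (rule that[of B A]) (use step AB(1,2) \<open>p \<in> B\<close> in blast)+
  qed
qed

end

section \<open>Star graphs of cyclic presentations\<close>

lemma reversible_star_graph:
  assumes "\<forall>r\<in>R. word_over X r"
  shows "reversible_digraph (star_graph X R) star_rev"
proof
  fix u assume u: "u \<in> arcs (star_graph X R)"
  then have "u \<in> symmetrized R" "2 \<le> length u" by (simp_all add: star_graph_def)
  moreover from this(1) assms have "fst ` set u \<subseteq> X"
    unfolding symmetrized_iff using cyclic_permutation_set word_over_inv word_over_def by metis
  moreover from \<open>2 \<le> length u\<close> have "u ! 0 \<in> set u" "u ! 1 \<in> set u"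
    by (intro nth_mem, linarith)+
  ultimately have "fst (u ! 0) \<in> X" "fst (u ! 1) \<in> X" by blast+
  then show "tail (star_graph X R) u \<in> verts (star_graph X R)"
    "head (star_graph X R) u \<in> verts (star_graph X R)"
    by (auto simp: star_graph_def inv_letter_def mem_Times_iff)
qed (auto simp: star_graph_def symmetrized_star_rev star_rev_ends star_rev_star_rev simp del: One_nat_def)

text \<open>Rotate \<open>w\<close> to start at \<open>a\<close> and read up to the first letter of
  the other sign; its predecessor has sign \<open>s\<close>.\<close>

lemma mixed_signs_adjacent:
  assumes "a \<in> set w" "snd a = s" "b \<in> set w" "snd b \<noteq> s"
  obtains u x y z where "cyclic_permutation u w" "u = (x, s) # (y, \<not> s) # z"
proof -
  from assms(1) obtain p q where w: "w = p @ a # q" by (auto simp: in_set_conv_decomp)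
  let ?c = "a # q @ p"
  have c: "cyclic_permutation ?c w" using w
    by (auto simp: cyclic_permutation_iff intro: exI[of _ p])
  have "\<exists>c\<in>set (q @ p). snd c \<noteq> s" using assms w by auto
  then obtain f c g where fcg: "q @ p = f @ c # g" "snd c \<noteq> s"
    "\<forall>x\<in>set f. \<not> snd x \<noteq> s"
    using split_list_first_propE[of "q @ p" "\<lambda>x. snd x \<noteq> s"] by metis
  \<comment> \<open>Prepending \<open>a\<close> provides the predecessor \<open>d\<close> even if
    \<open>f\<close> is empty.\<close>
  obtain f' d where d: "a # f = f' @ [d]" by (metis append_butlast_last_id list.distinct(1))
  have "d \<in> set (a # f)" unfolding d by simp
  then have "snd d = s" using fcg(3) assms(2) by auto
  have "?c = f' @ (d # c # g)" using fcg(1) d by simp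
  then have "cyclic_permutation ((d # c # g) @ f') ?c" unfolding cyclic_permutation_iff by blast
  then have "cyclic_permutation (d # c # g @ f') w" using c cyclic_permutation_trans by fastforce
  moreover obtain x y where "d = (x, s)" "c = (y, \<not> s)"
    using \<open>snd d = s\<close> fcg(2) by (cases d, cases c) auto
  ultimately show thesis using that[of "d # c # g @ f'" x y "g @ f'"] by simp
qed

lemma star_graph_dominates_iff:
  "p \<rightarrow>\<^bsub>star_graph X R\<^esub> q \<longleftrightarrow>
    (\<exists>u\<in>symmetrized R. 2 \<le> length u \<and> u ! 0 = p \<and> inv_letter (u ! 1) = q)"
  by (auto simp: arcs_ends_def arc_to_ends_def star_graph_def)

text \<open>A sign change in the cyclic word becomes an edge inside a copy, since the head of an arc
  inverts the second letter.\<close>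

lemma star_graph_same_sign:
  assumes "0 < n" "word_over {..<n} w" "a \<in> set w" "snd a = s" "b \<in> set w"
    "snd b \<noteq> s"
  obtains i j where "(i, s) \<rightarrow>\<^bsub>star_graph X (cyclic_relators n w)\<^esub> (j, s)"
proof -
  obtain u x y z where u: "cyclic_permutation u w" "u = (x, s) # (y, \<not> s) # z"
    using mixed_signs_adjacent[OF assms(3-6)] .
  have "u \<in> symmetrized (cyclic_relators n w)"
    unfolding symmetrized_cyclic_relators_iff[OF assms(1,2)] using u(1)
      by (auto intro!: exI[of _ 0])
  then have "(x, s) \<rightarrow>\<^bsub>star_graph X (cyclic_relators n w)\<^esub> (y, s)"
    unfolding star_graph_dominates_iff using u(2)
      by (intro bexI[of _ u]) (simp_all add: inv_letter_def)
  then show thesis by (rule that)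
qed

text \<open>An edge inside a copy comes from adjacent letters of opposite sign. Shifts keep all
  signs and inversion flips all of them, so \<open>w\<close> itself would contain both
  signs.\<close>

lemma star_graph_no_same_sign:
  assumes "0 < n" "word_over {..<n} w" "snd ` set w \<noteq> UNIV"
  shows "\<not> (i, s) \<rightarrow>\<^bsub>star_graph X (cyclic_relators n w)\<^esub> (j, s)"
proof
  assume "(i, s) \<rightarrow>\<^bsub>star_graph X (cyclic_relators n w)\<^esub> (j, s)"
  then obtain u where u: "u \<in> symmetrized (cyclic_relators n w)" "2 \<le> length u"
    "u ! 0 = (i, s)"
    "inv_letter (u ! 1) = (j, s)" unfolding star_graph_dominates_iff by blast
  have "s \<in> snd ` set u" using nth_mem[of 0 u] u(2,3) by (force simp: image_iff)
  moreover have "\<not> s = snd (u ! 1)" using u(4) by (auto simp: inv_letter_def)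
  then have "(\<not> s) \<in> snd ` set u" using nth_mem[of 1 u] u(2) by (force simp: image_iff)
  ultimately have "snd ` set u = UNIV" by (cases s) (auto simp: UNIV_bool)
  moreover obtain i
    where "set u = set ((shift n ^^ i) w) \<or> set u = set (inv_word ((shift n ^^ i) w))"
    using u(1) unfolding symmetrized_cyclic_relators_iff[OF assms(1,2)]
    using cyclic_permutation_set by (metis inv_word_shift)
  moreover have "snd ` set (inv_word ((shift n ^^ i) w)) = Not ` snd ` set ((shift n ^^ i) w)"
    by (simp add: inv_word_def image_image inv_letter_def)
  ultimately have "snd ` set w = UNIV \<or> Not ` snd ` set w = UNIV" by (metis snd_set_shift)
  then show False
  proof
    assume "Not ` snd ` set w = UNIV"
    then have "Not ` Not ` snd ` set w = Not ` UNIV" by (rule arg_cong)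
    also have "\<dots> = UNIV" by (auto simp: UNIV_bool)
    finally have "snd ` set w = UNIV" by (simp only: image_image not_not image_ident)
    then show False using assms(3) by simp
  qed (use assms(3) in simp)
qed

lemma symmetrized_word_over:
  "\<forall>r\<in>R. word_over X r \<Longrightarrow> u \<in> symmetrized R \<Longrightarrow> word_over X u"
  unfolding symmetrized_iff by (metis cyclic_permutation_set word_over_inv word_over_def)

lemma star_graph_shift_arc:
  assumes "0 < n" "word_over {..<n} w" "u \<in> symmetrized (cyclic_relators n w)"
    "2 \<le> length u"
    and "u ! 0 = (i, s)" "inv_letter (u ! 1) = (j, s')"
  shows "(shift n ^^ t) u \<in> symmetrized (cyclic_relators n w)"
    "2 \<le> length ((shift n ^^ t) u)"
    "(shift n ^^ t) u ! 0 = ((i + t) mod n, s)"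
    "inv_letter ((shift n ^^ t) u ! 1) = ((j + t) mod n, s')"
proof -
  have "\<forall>r\<in>cyclic_relators n w. word_over {..<n} r"
    using assms(1,2) word_over_shift by (auto simp: cyclic_relators_def)
  then have "word_over {..<n} u" using assms(3) symmetrized_word_over by blast
  moreover have "u \<noteq> []" using assms(4) by auto
  moreover have "u ! 1 = (j, \<not> s')" using assms(6)
    by (metis inv_letter_inv inv_letter_def fst_conv snd_conv)
  ultimately show "(shift n ^^ t) u ! 0 = ((i + t) mod n, s)"
    "inv_letter ((shift n ^^ t) u ! 1) = ((j + t) mod n, s')"
    using assms(4,5) nth_map[of 0 u] nth_map[of 1 u] \<open>u \<noteq> []\<close>
    by (simp_all add: shift_power inv_letter_def)
qed (use assms symmetrized_shift in simp_all)

theorem corollary5p5: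
  fixes n m k \<nu> :: nat and w :: "nat word"
  assumes "word_over {..<n} w"
    and "w \<noteq> []"
    and "cyclically_reduced w"
    and "orientable n w"
    and "special m k \<nu> {..<n} (cyclic_relators n w)"
    and "3 \<le> m"
  shows "m = 3 \<and> (positive_word w \<or> negative_word w)"
proof -
  let ?R = "cyclic_relators n w"
  let ?G = "star_graph {..<n} ?R"
  have n: "0 < n" using assms(1,2) by (cases w) (auto simp: word_over_def)
  have over: "\<forall>r\<in>?R. word_over {..<n} r"
    using assms(5) by (simp add: special_def)
  interpret G: reversible_digraph ?G star_rev by (rule reversible_star_graph[OF over])
  let ?E = "\<lambda>p q. p \<rightarrow>\<^bsub>?G\<^esub> q"
  have girth: "\<forall>C\<in>G.sccs. girth star_rev C = enat (2 * m)"
    and comp: "\<And>C. C \<in> G.sccs \<Longrightarrow> bipartite C \<and> diam C = enat m \<and> (\<forall>v\<in>verts C. 3 \<le> out_degree C v)"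
    using assms(5) by (auto simp: special_def)
  have m: "3 \<le> 2 * m" using assms(6) by simp
  have verts: "verts ?G = {..<n} \<times> UNIV" by (simp add: star_graph_def)
  \<comment> \<open>Shifting by \<open>j - i\<close> exchanges the ends of the arc \<open>u\<close>.
    Reversing the shifted arc gives an arc parallel to \<open>u\<close>, hence \<open>u\<close>
    itself, so \<open>u\<close> is a cyclic permutation of the inverse of its own shift, against
    orientability.\<close>
  have half: False if E: "?E (i, s) (j, s)" and eq: "(2 * i) mod n = (2 * j) mod n" for i j s
  proof -
    obtain u where u: "u \<in> symmetrized ?R" "2 \<le> length u" "u ! 0 = (i, s)"
      "inv_letter (u ! 1) = (j, s)"
      using E unfolding star_graph_dominates_iff by blast
    have lt: "i < n" "j < n" using G.adj_in_verts[OF E] by (auto simp: verts)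
    \<comment> \<open>The difference \<open>j - i\<close> modulo \<open>n\<close>, kept natural by
      adding \<open>n\<close>.\<close>
    define t where "t = j + n - i"
    let ?u = "(shift n ^^ t) u"
    note arc = star_graph_shift_arc[OF n assms(1) u, of t]
    have "(i + t) mod n = j" using lt by (simp add: t_def)
    moreover have "(j + t) mod n = i"
    proof -
      have "2 * j = 2 * i \<or> 2 * j = 2 * i + n \<or> 2 * i = 2 * j + n"
        using lt eq by (auto simp: mod_if split: if_splits)
      then have "j + t = i + n \<or> j + t = i + 2 * n \<or> j + t = i" using lt
        by (auto simp: t_def)
      then show ?thesis using lt by auto
    qed
    ultimately have "?u ! 0 = (j, s)" "inv_letter (?u ! 1) = (i, s)" using arc by simp_all
    then have "star_rev ?u ! 0 = u ! 0" "inv_letter (star_rev ?u ! 1) = inv_letter (u ! 1)"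
      using u star_rev_ends[OF arc(2)] by simp_all
    then have "star_rev ?u = u"
      using arc(1,2) u symmetrized_star_rev[OF arc(1,2)]
      by (intro G.no_parallel_arcs[OF girth m]) (simp_all add: star_graph_def)
    then have "cyclic_permutation u (inv_word ?u)" using star_rev_cyclic[OF arc(2)] by simp
    then show False using orientable_no_reversal[OF n assms(1,4) u(1)] by blast
  qed
  interpret cyclic_graph ?E m n
  proof
    show "p \<rightarrow>\<^bsub>?G\<^esub> q \<Longrightarrow> q \<rightarrow>\<^bsub>?G\<^esub> p"
      for p q by (rule G.dominates_sym)
    show "finite {q. p \<rightarrow>\<^bsub>?G\<^esub> q}" for p
    proof (rule finite_subset)
      show "{q. p \<rightarrow>\<^bsub>?G\<^esub> q} \<subseteq> verts ?G" using G.adj_in_verts(2)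
        by blast
    qed (simp add: verts)
    show "2 * m < length vs" if "nb_walk ?E vs" "2 \<le> length vs" "hd vs = last vs" for vs
      by (rule G.nb_walk_length[OF girth that])
    show "fst p < n" if "?E p q" for p q using G.adj_in_verts(1)[OF that] by (auto simp: verts)
    show "?E ((i + 1) mod n, s) ((j + 1) mod n, s')" if E: "?E (i, s) (j, s')" for i j s s'
    proof -
      obtain u where "u \<in> symmetrized ?R" "2 \<le> length u" "u ! 0 = (i, s)"
        "inv_letter (u ! 1) = (j, s')"
        using E unfolding star_graph_dominates_iff by blast
      from star_graph_shift_arc[OF n assms(1) this, of 1] show ?thesis
        unfolding star_graph_dominates_iff by blast
    qed
    show "3 \<le> card {q. p \<rightarrow>\<^bsub>?G\<^esub> q}" if "fst p < n" for p
    proof -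
      have p: "p \<in> verts ?G" using that by (cases p) (simp add: verts)
      then have "p \<in> verts (G.component p)" by (simp add: G.component_sel)
      then show ?thesis
        using G.card_dominates[OF girth m p] comp[OF G.component_in_sccs[OF p]] by simp
    qed
  qed (use n assms(6) half in auto)
  have signs: "snd ` set w \<noteq> UNIV"
  proof
    assume UN: "snd ` set w = UNIV"
    then have "True \<in> snd ` set w" "False \<in> snd ` set w" by simp_all
    then obtain a b where ab: "a \<in> set w" "snd a = True" "b \<in> set w" "snd b = False"
      by force
    obtain i j where ij: "?E (i, True) (j, True)"
      using star_graph_same_sign[OF n assms(1) ab(1,2,3)] ab(4) by metis
    obtain i' j' where ij': "?E (i', False) (j', False)"
      using star_graph_same_sign[OF n assms(1) ab(3,4,1)] ab(2) by metis
    \<comment> \<open>The two edges found above may lie outside the component of this vertex;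
      rotation invariance transports their steps into it.\<close>
    let ?p = "(0, True) :: nat letter"
    have p: "?p \<in> verts ?G" using n by (simp add: verts)
    note c = comp[OF G.component_in_sccs[OF p]]
    obtain S T where ST: "S \<union> T = verts (G.component ?p)" "S \<inter> T = {}" "?p \<in> S"
      "\<And>u v. u \<in> S \<Longrightarrow> ?E u v \<Longrightarrow> v \<in> T"
        "\<And>u v. u \<in> T \<Longrightarrow> ?E u v \<Longrightarrow> v \<in> S"
      using G.bipartite_component[OF _ p] c by blast
    interpret cyclic_polygon ?E m n S T
    proof
      show "\<exists>vs. successively ?E vs \<and> vs \<noteq> [] \<and> hd vs = p \<and> last vs = q \<and> length vs \<le> m + 1"
        if "p \<in> S" "q \<in> S \<union> T" for p q
        using that ST(1) c by (intro G.diameter_walk[of ?p]) auto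
      have "verts (G.component ?p) \<subseteq> verts ?G"
        by (auto simp: G.component_sel dest: G.reachable_in_verts)
      then show "S \<union> T \<subseteq> {..<n} \<times> UNIV" by (simp add: ST(1) verts)
    qed (use ST in auto)
    from no_both_same_signs[OF ij ij'] show False .
  qed
  then have "\<not> ?E (i, True) (j, True)" for i j
    using star_graph_no_same_sign[OF n assms(1)] by blast
  then have "m = 3" using m_le_3_of_no_same assms(6) by force
  moreover have "positive_word w \<or> negative_word w"
  proof -
    obtain s where "s \<notin> snd ` set w" using signs by blast
    then have "snd a \<noteq> s" if "a \<in> set w" for a using that by blast
    then show ?thesis using assms(2) by (cases s) (auto simp: positive_word_def negative_word_def)
  qed
  ultimately show ?thesis ..
qed

end
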